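(* For any $0<\delta\le 1$ there exists $\gamma=\gamma(\delta)>0$ such that for any positive integer $n$ and any $0<\epsilon<1$ there exists a polynomial $p=p_{n,\delta,\epsilon}$ in the entries $a_{ij}$ of an $n\times n$ matrix $A$ such that $\deg p\le \gamma(\ln n-\ln\epsilon)$ and $$\left|\ln \operatorname{per} A-p(A)\right|\le\epsilon$$ for all $n\times n$ real matrices $A=(a_{ij})$ satisfying $\delta\le a_{ij}\le 1$ for all $i,j$.
   Context: The permanent of an $n\times n$ real or complex matrix $A=(a_{ij})$ is $\operatorname{per}A=\sum_{\sigma\in S_n}\prod_{i=1}^n a_{i\sigma(i)}$, where $S_n$ is the symmetric group of permutations of $\{1,\dots,n\}$.
   Formalization: In the degree bound, ln n is replaced by ln max(2,n). This changes only n = 1, where the printed bound fails: as ε tends to 1 it forces p to be constant, and no constant is within ε < 1 of ln a on δ ≤ a ≤ 1 when δ ≤ exp(-2). *)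

theory Defs
  imports Complex_Main "HOL-Library.Poly_Mapping" "Jordan_Normal_Form.Matrix"
    "HOL-Combinatorics.Permutations"
begin

(* Matrix indices run over 0, ..., n - 1 as in Jordan_Normal_Form.
   Meant for square matrices, like the determinant. *)
definition permanent :: "'a::comm_ring_1 mat \<Rightarrow> 'a" where
  "permanent A = (\<Sum>\<sigma> | \<sigma> permutes {0..<dim_row A}. \<Prod>i = 0..<dim_row A. A $$ (i, \<sigma> i))"

(* Polynomials in indeterminates of type 'v with coefficients in 'a: finitely supported maps
   from monomials to coefficients, a monomial being a finitely supported map from
   indeterminates to exponents. *)
type_synonym ('v, 'a) mpoly = "('v \<Rightarrow>\<^sub>0 nat) \<Rightarrow>\<^sub>0 'a"

definition mpoly_vars :: "('v, 'a::zero) mpoly \<Rightarrow> 'v set" where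
  "mpoly_vars p = (\<Union>m\<in>Poly_Mapping.keys p. Poly_Mapping.keys m)"

(* Total degree; the zero polynomial has degree 0. *)
definition mpoly_degree :: "('v, 'a::zero) mpoly \<Rightarrow> nat" where
  "mpoly_degree p = Max (insert 0 ((\<lambda>m. \<Sum>v\<in>Poly_Mapping.keys m. Poly_Mapping.lookup m v)
    ` Poly_Mapping.keys p))"

definition mpoly_eval :: "('v \<Rightarrow> 'a) \<Rightarrow> ('v, 'a::comm_semiring_1) mpoly \<Rightarrow> 'a" where
  "mpoly_eval x p = (\<Sum>m\<in>Poly_Mapping.keys p. Poly_Mapping.lookup p m *
    (\<Prod>v\<in>Poly_Mapping.keys m. x v ^ Poly_Mapping.lookup m v))"

end

theory Submission
  imports Defs "HOL-Analysis.Complex_Transcendental" "HOL-Computational_Algebra.Polynomial_FPS"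
    "HOL-Computational_Algebra.Fundamental_Theorem_Algebra"
begin

text \<open>
The proof is Barvinok's interpolation method: approximate the logarithm of the permanent by a Taylor
polynomial along a path on which the permanent has no zeros.

Let \<open>J\<close> be the all-ones matrix. The permanent of \<open>J + w (A - J)\<close> is a polynomial in \<open>w\<close> with values
\<open>n!\<close> at 0 and \<open>per A\<close> at 1. It has no zeros for \<open>w\<close> in a rectangle around the segment from 0 to 1
whose margin \<open>\<rho>\<close> depends only on \<open>\<delta>\<close>. The reason (\<open>block_permanents_acute\<close>) is that permanents of
submatrices that differ in one row or one column form an acute angle in the complex plane. This
passes from one size to the next because row and column expansions have coefficients with small
imaginary part and real part bounded away from 0, and such combinations of vectors with
pairwise acute angles form acute angles again (\<open>acute_combinations\<close>).

A Taylor expansion at 0 of the logarithm need not converge at \<open>w = 1\<close>, since the rectangle does not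
contain a disc around 0 of radius 1. Hence \<open>w = \<phi>(z)\<close> is substituted, where the polynomial \<open>\<phi>\<close>
satisfies \<open>\<phi>(0) = 0\<close> and \<open>\<phi>(1) = 1\<close> and maps a disc of radius \<open>\<beta> > 1\<close> into the rectangle
(\<open>polynomial_disc_to_strip\<close>). The permanent becomes a polynomial \<open>H\<close> in \<open>z\<close> of degree at most
\<open>n * degree \<phi>\<close> all of whose roots have modulus greater than \<open>\<beta>\<close>. Each root contributes to \<open>ln H(1)\<close>
a series with geometric decay, so truncation after \<open>m\<close> terms leaves an error of order
\<open>n * \<beta> ^ (- m)\<close> (\<open>ln_poly_truncation\<close>), which is at most \<open>\<epsilon>\<close> for some \<open>m\<close> of order \<open>ln n - ln \<epsilon>\<close>.

The truncated series is a polynomial in the entries of \<open>A\<close>: the coefficient of \<open>z ^ k\<close> in \<open>H\<close> has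
degree at most \<open>k\<close> in them and the constant coefficient \<open>n!\<close> does not depend on \<open>A\<close>, so the \<open>k\<close>-th
Taylor coefficient of \<open>ln H\<close> also has degree at most \<open>k\<close> (\<open>poly_fun_log_deriv\<close>).
\<close>

section \<open>Permanents as sums over matchings\<close>

text \<open>
A bijection from \<open>R\<close> to \<open>C\<close> is encoded by its graph. Graphs treat rows and columns alike:
transposition is the converse relation, so every statement on columns follows from the one on rows.
\<close>
definition matchings :: "'a set \<Rightarrow> 'b set \<Rightarrow> ('a \<times> 'b) set set" where
  "matchings R C = {M. M \<subseteq> R \<times> C \<and> (\<forall>i\<in>R. \<exists>!j. (i, j) \<in> M) \<and> (\<forall>j\<in>C. \<exists>!i. (i, j) \<in> M)}"

text \<open>
The permanent of the submatrix with rows \<open>R\<close> and columns \<open>C\<close>. Keeping the row and column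
sets as parameters makes minors available without any renumbering of indices.
\<close>
definition block_permanent :: "('a \<Rightarrow> 'b \<Rightarrow> 'c::comm_semiring_1) \<Rightarrow> 'a set \<Rightarrow> 'b set \<Rightarrow> 'c" where
  "block_permanent f R C = (\<Sum>M\<in>matchings R C. \<Prod>(i, j)\<in>M. f i j)"

lemma finite_matchings: "finite R \<Longrightarrow> finite C \<Longrightarrow> finite (matchings R C)"
  by (rule finite_subset[of _ "Pow (R \<times> C)"]) (auto simp: matchings_def)

lemma finite_matching: "finite R \<Longrightarrow> finite C \<Longrightarrow> M \<in> matchings R C \<Longrightarrow> finite M"
  by (rule finite_subset[of _ "R \<times> C"]) (auto simp: matchings_def)

lemma card_matching_le:
  assumes "finite R" "M \<in> matchings R C"
  shows "card M \<le> card R"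
proof (rule card_inj_on_le[of fst])
  have sub: "M \<subseteq> R \<times> C" and uniq: "\<And>i. i \<in> R \<Longrightarrow> \<exists>!j. (i, j) \<in> M"
    using assms(2) by (auto simp: matchings_def)
  show "inj_on fst M"
    using sub uniq by (fastforce simp: inj_on_def)
  show "fst ` M \<subseteq> R"
    using sub by auto
qed (use assms in simp)

lemma matchings_empty: "matchings {} {} = {{}}"
  by (auto simp: matchings_def)

lemma block_permanent_empty: "block_permanent f {} {} = 1"
  by (simp add: block_permanent_def matchings_empty)

lemma converse_matching: "M \<in> matchings R C \<Longrightarrow> M\<inverse> \<in> matchings C R"
  by (simp add: matchings_def) blast

lemma block_permanent_transpose:
  "block_permanent (\<lambda>j i. f i j) C R = block_permanent f R C"
  unfolding block_permanent_def
proof (rule sum.reindex_bij_witness[of _ converse converse])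
  fix M assume "M \<in> matchings C R"
  show "(\<Prod>(i, j)\<in>M\<inverse>. f i j) = (\<Prod>(j, i)\<in>M. f i j)"
    by (rule prod.reindex_bij_witness[of _ prod.swap prod.swap]) auto
qed (auto intro: converse_matching)

text \<open>
A matching of \<open>insert r R\<close> with \<open>C\<close> is a partner \<open>j\<close> for \<open>r\<close> together with a matching of the rest.
\<close>
lemma block_permanent_expand_row:
  assumes "finite R" "finite C" "r \<notin> R"
  shows "block_permanent f (insert r R) C = (\<Sum>j\<in>C. f r j * block_permanent f R (C - {j}))"
proof -
  have "(\<Sum>j\<in>C. f r j * block_permanent f R (C - {j})) =
      (\<Sum>(j, M)\<in>(SIGMA j:C. matchings R (C - {j})). f r j * (\<Prod>(i, j)\<in>M. f i j))"
    using assms by (simp add: block_permanent_def sum_distrib_left sum.Sigma finite_matchings)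
  also have "\<dots> = (\<Sum>M\<in>matchings (insert r R) C. \<Prod>(i, j)\<in>M. f i j)"
  proof (rule sum.reindex_bij_witness[of _ "\<lambda>M. (THE j. (r, j) \<in> M, {p \<in> M. fst p \<noteq> r})"
        "\<lambda>(j, M). insert (r, j) M"])
    fix jM assume jM: "jM \<in> (SIGMA j:C. matchings R (C - {j}))"
    then obtain j M where [simp]: "jM = (j, M)" and j: "j \<in> C" and M: "M \<in> matchings R (C - {j})"
      by auto
    have nr: "fst p \<noteq> r" if "p \<in> M" for p
      using M assms(3) that by (auto simp: matchings_def)
    have "(THE k. (r, k) \<in> insert (r, j) M) = j"
      using nr by (intro the_equality) force+
    then show "(THE k. (r, k) \<in> (case jM of (j, M) \<Rightarrow> insert (r, j) M),
         {p \<in> case jM of (j, M) \<Rightarrow> insert (r, j) M. fst p \<noteq> r}) = jM"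
      using nr by auto
    show "(case jM of (j, M) \<Rightarrow> insert (r, j) M) \<in> matchings (insert r R) C"
      using M j assms(3) by (auto simp: matchings_def) blast+
    have "(r, j) \<notin> M" using nr by force
    then show "(\<Prod>(i, j)\<in>(case jM of (j, M) \<Rightarrow> insert (r, j) M). f i j) =
        (case jM of (j, M) \<Rightarrow> f r j * (\<Prod>(i, j)\<in>M. f i j))"
      using finite_matching[OF _ _ M] assms by simp
  next
    fix M assume M: "M \<in> matchings (insert r R) C"
    then obtain j where j: "(r, j) \<in> M" "j \<in> C" and uniq: "\<And>k. (r, k) \<in> M \<Longrightarrow> k = j"
      unfolding matchings_def by blast
    have the: "(THE j. (r, j) \<in> M) = j"
      using j uniq by blast
    have "insert (r, j) {p \<in> M. fst p \<noteq> r} = M"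
      using j(1) by (auto dest: uniq)
    then show "(case (THE j. (r, j) \<in> M, {p \<in> M. fst p \<noteq> r}) of (j, M) \<Rightarrow> insert (r, j) M) = M"
      by (simp only: the prod.case)
    have "\<exists>!i. (i, k) \<in> {p \<in> M. fst p \<noteq> r}" if "k \<in> C - {j}" for k
    proof -
      have "\<exists>!i. (i, k) \<in> M" using M that by (simp add: matchings_def)
      then show ?thesis using uniq that by fastforce
    qed
    moreover have "\<exists>!k. (i, k) \<in> {p \<in> M. fst p \<noteq> r}" if "i \<in> R" for i
    proof -
      have "\<exists>!k. (i, k) \<in> M" using M that by (simp add: matchings_def)
      then show ?thesis using assms(3) that by auto
    qed
    moreover have "{p \<in> M. fst p \<noteq> r} \<subseteq> R \<times> (C - {j})"
    proof -
      have sub: "M \<subseteq> insert r R \<times> C" and "\<exists>!i. (i, j) \<in> M" 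
        using M j(2) by (simp_all add: matchings_def)
      then have "i = r" if "(i, j) \<in> M" for i using j(1) that by blast
      then show ?thesis using sub by auto
    qed
    ultimately have "{p \<in> M. fst p \<noteq> r} \<in> matchings R (C - {j})"
      by (simp add: matchings_def)
    then show "(THE j. (r, j) \<in> M, {p \<in> M. fst p \<noteq> r}) \<in> (SIGMA j:C. matchings R (C - {j}))"
      using the j(2) by simp
  qed
  finally show ?thesis by (simp add: block_permanent_def)
qed

lemma block_permanent_expand_column:
  assumes "finite R" "finite C" "c \<notin> C"
  shows "block_permanent f R (insert c C) = (\<Sum>i\<in>R. f i c * block_permanent f (R - {i}) C)"
  using block_permanent_expand_row[OF assms(2,1,3), of "\<lambda>j i. f i j"]
  by (simp add: block_permanent_transpose[of f])

text \<open>
The graph of a permutation is a matching; a matching determines the permutation, which is the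
identity outside the index range.
\<close>
lemma permanent_eq_block_permanent:
  assumes "A \<in> carrier_mat n n"
  shows "permanent A = block_permanent (\<lambda>i j. A $$ (i, j)) {0..<n} {0..<n}"
  unfolding permanent_def block_permanent_def
proof (rule sum.reindex_bij_witness[of _
      "\<lambda>M i. if i < n then THE j. (i, j) \<in> M else i" "\<lambda>\<sigma>. (\<lambda>i. (i, \<sigma> i)) ` {0..<n}"])
  fix \<sigma> assume "\<sigma> \<in> {\<sigma>. \<sigma> permutes {0..<dim_row A}}"
  then have \<sigma>: "\<sigma> permutes {0..<n}" using assms by auto
  then show "(\<lambda>i. if i < n then THE j. (i, j) \<in> (\<lambda>i. (i, \<sigma> i)) ` {0..<n} else i) = \<sigma>"
    by (intro ext) (auto simp: permutes_def image_iff)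
  have "bij_betw \<sigma> {0..<n} {0..<n}" using \<sigma> by (rule permutes_imp_bij)
  then have "\<exists>!i. i \<in> {0..<n} \<and> \<sigma> i = j" if "j \<in> {0..<n}" for j
    using that unfolding bij_betw_def inj_on_def by (metis (no_types, lifting) imageE)
  then have "\<exists>!i. (i, j) \<in> (\<lambda>i. (i, \<sigma> i)) ` {0..<n}" if "j \<in> {0..<n}" for j
    using that by (simp add: image_iff) metis
  moreover have "\<exists>!j. (i, j) \<in> (\<lambda>i. (i, \<sigma> i)) ` {0..<n}" if "i \<in> {0..<n}" for i
    using that by (intro ex1I[of _ "\<sigma> i"]) auto
  moreover have "(\<lambda>i. (i, \<sigma> i)) ` {0..<n} \<subseteq> {0..<n} \<times> {0..<n}"
    using permutes_in_image[OF \<sigma>] by (intro image_subsetI SigmaI) blast+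
  ultimately show "(\<lambda>i. (i, \<sigma> i)) ` {0..<n} \<in> matchings {0..<n} {0..<n}"
    by (simp add: matchings_def)
  show "(\<Prod>(i, j)\<in>(\<lambda>i. (i, \<sigma> i)) ` {0..<n}. A $$ (i, j)) = (\<Prod>i = 0..<dim_row A. A $$ (i, \<sigma> i))"
    using assms by (subst prod.reindex) (auto simp: inj_on_def)
next
  fix M assume M: "M \<in> matchings {0..<n} {0..<n}"
  define s where "s = (\<lambda>i. if i < n then THE j. (i, j) \<in> M else i)"
  have sub: "M \<subseteq> {0..<n} \<times> {0..<n}" and row: "\<And>i. i < n \<Longrightarrow> \<exists>!j. (i, j) \<in> M"
    and col: "\<And>j. j < n \<Longrightarrow> \<exists>!i. (i, j) \<in> M"
    using M by (auto simp: matchings_def)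
  have s: "(i, j) \<in> M \<longleftrightarrow> i < n \<and> j = s i" for i j
  proof (cases "i < n")
    case True
    then have "(i, s i) \<in> M" using theI'[OF row[OF True]] by (simp add: s_def)
    then show ?thesis using row[OF True] True by blast
  qed (use sub in auto)
  have sn: "s i < n" if "i < n" for i
    using s[of i "s i"] sub that by auto
  have "bij_betw s {0..<n} {0..<n}"
  proof (rule bij_betwI')
    fix i k assume "i \<in> {0..<n}" "k \<in> {0..<n}"
    then show "s i = s k \<longleftrightarrow> i = k"
      using col[of "s i"] sn[of i] s by auto
  next
    fix j assume "j \<in> {0..<n}"
    then obtain i where "(i, j) \<in> M" using col[of j] by (auto elim: ex1E)
    then show "\<exists>i\<in>{0..<n}. j = s i"
      using s by auto
  qed (use sn in auto)
  then have "s permutes {0..<n}"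
    by (rule bij_imp_permutes) (simp add: s_def)
  then show "(\<lambda>i. if i < n then THE j. (i, j) \<in> M else i) \<in> {\<sigma>. \<sigma> permutes {0..<dim_row A}}"
    using assms by (simp add: s_def)
  have "(\<lambda>i. (i, s i)) ` {0..<n} = M"
    using s by (auto simp: image_iff)
  then show "(\<lambda>i. (i, if i < n then THE j. (i, j) \<in> M else i)) ` {0..<n} = M"
    by (simp only: s_def)
qed

section \<open>A zero-free region for the permanent\<close>

lemma inner_sum_scaleR:
  fixes u :: "'a \<Rightarrow> 'b::real_inner"
  shows "inner (\<Sum>j\<in>J. a j *\<^sub>R u j) (\<Sum>j\<in>J. b j *\<^sub>R u j) =
    (\<Sum>j\<in>J. \<Sum>k\<in>J. a j * b k * inner (u j) (u k))"
proof -
  have "inner (\<Sum>j\<in>J. a j *\<^sub>R u j) (\<Sum>j\<in>J. b j *\<^sub>R u j) =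
      (\<Sum>j\<in>J. inner (a j *\<^sub>R u j) (\<Sum>k\<in>J. b k *\<^sub>R u k))"
    by (rule inner_sum_left)
  also have "\<dots> = (\<Sum>j\<in>J. \<Sum>k\<in>J. inner (a j *\<^sub>R u j) (b k *\<^sub>R u k))"
    by (simp only: inner_sum_right)
  finally show ?thesis by (simp add: ac_simps)
qed

text \<open>
In the expansion of the squared norm the Gram matrix of \<open>u\<close> has only nonnegative entries, so it
can only grow when each coefficient is replaced by the bound \<open>c\<close>.
\<close>
lemma norm_sum_scaleR_le:
  fixes u :: "'a \<Rightarrow> 'b::real_inner"
  assumes acute: "\<And>j k. j \<in> J \<Longrightarrow> k \<in> J \<Longrightarrow> 0 \<le> inner (u j) (u k)"
    and c: "\<And>j. j \<in> J \<Longrightarrow> \<bar>a j\<bar> \<le> c" "0 \<le> c"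
  shows "norm (\<Sum>j\<in>J. a j *\<^sub>R u j) \<le> c * norm (\<Sum>j\<in>J. u j)"
proof -
  have "(norm (\<Sum>j\<in>J. a j *\<^sub>R u j))\<^sup>2 = (\<Sum>j\<in>J. \<Sum>k\<in>J. a j * a k * inner (u j) (u k))"
    by (simp only: power2_norm_eq_inner inner_sum_scaleR)
  also have "\<dots> \<le> (\<Sum>j\<in>J. \<Sum>k\<in>J. c * c * inner (u j) (u k))"
  proof (intro sum_mono mult_right_mono acute)
    fix j k assume "j \<in> J" "k \<in> J"
    then have "\<bar>a j\<bar> * \<bar>a k\<bar> \<le> c * c"
      using c by (intro mult_mono) auto
    then show "a j * a k \<le> c * c" 
      by (metis abs_le_D1 abs_mult)
  qed
  also have "\<dots> = (c * norm (\<Sum>j\<in>J. u j))\<^sup>2"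
    using inner_sum_scaleR[of "\<lambda>_. c" u J "\<lambda>_. c"]
    by (simp add: power_mult_distrib power2_norm_eq_inner flip: scaleR_sum_right) (simp add: power2_eq_square)
  finally show ?thesis
    by (rule power2_le_imp_le) (use c(2) in simp)
qed

lemma inner_sum_scaleR_ge:
  fixes u :: "'a \<Rightarrow> 'b::real_inner"
  assumes acute: "\<And>j k. j \<in> J \<Longrightarrow> k \<in> J \<Longrightarrow> 0 \<le> inner (u j) (u k)"
    and c: "\<And>j. j \<in> J \<Longrightarrow> c \<le> a j" "\<And>j. j \<in> J \<Longrightarrow> c \<le> b j" "0 \<le> c"
  shows "c\<^sup>2 * (norm (\<Sum>j\<in>J. u j))\<^sup>2 \<le> inner (\<Sum>j\<in>J. a j *\<^sub>R u j) (\<Sum>j\<in>J. b j *\<^sub>R u j)"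
proof -
  have "c\<^sup>2 * (norm (\<Sum>j\<in>J. u j))\<^sup>2 = (\<Sum>j\<in>J. \<Sum>k\<in>J. c * c * inner (u j) (u k))"
    using inner_sum_scaleR[of "\<lambda>_. c" u J "\<lambda>_. c"]
    by (simp add: power2_norm_eq_inner flip: scaleR_sum_right) (simp add: power2_eq_square)
  also have "\<dots> \<le> (\<Sum>j\<in>J. \<Sum>k\<in>J. a j * b k * inner (u j) (u k))"
    by (intro sum_mono mult_right_mono acute mult_mono) (use c in \<open>auto intro: order_trans\<close>)
  also have "\<dots> = inner (\<Sum>j\<in>J. a j *\<^sub>R u j) (\<Sum>j\<in>J. b j *\<^sub>R u j)"
    by (simp only: inner_sum_scaleR)
  finally show ?thesis .
qed

definition in_rectangle :: "real \<Rightarrow> real \<Rightarrow> real \<Rightarrow> complex \<Rightarrow> bool" where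
  "in_rectangle lo hi \<tau> z \<longleftrightarrow> lo \<le> Re z \<and> Re z \<le> hi \<and> \<bar>Im z\<bar> \<le> \<tau>"

text \<open>
The inductive step of the zero-free region. With the coefficients split into real and imaginary
parts, the real parts contribute at least \<open>lo\<^sup>2 * s\<^sup>2\<close> to the inner product, where \<open>s\<close> is the norm of
the sum of all \<open>u j\<close>, because their coefficients are bounded below. Every other contribution
involves an imaginary part, and together they have modulus at most \<open>(2 * hi * \<tau> + \<tau>\<^sup>2) * s\<^sup>2\<close>.
\<close>
lemma acute_combinations:
  fixes u a b :: "'a \<Rightarrow> complex"
  assumes J: "finite J" "J \<noteq> {}"
    and acute: "\<And>j k. j \<in> J \<Longrightarrow> k \<in> J \<Longrightarrow> 0 < inner (u j) (u k)"
    and a: "\<And>j. j \<in> J \<Longrightarrow> in_rectangle lo hi \<tau> (a j)"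
    and b: "\<And>j. j \<in> J \<Longrightarrow> in_rectangle lo hi \<tau> (b j)"
    and lo: "0 < lo" and dom: "2 * hi * \<tau> + \<tau>\<^sup>2 < lo\<^sup>2"
  shows "0 < inner (\<Sum>j\<in>J. a j * u j) (\<Sum>j\<in>J. b j * u j)"
proof -
  have acute': "0 \<le> inner (u j) (u k)" if "j \<in> J" "k \<in> J" for j k
    using acute that by (simp add: less_imp_le)
  define s where "s = norm (\<Sum>j\<in>J. u j)"
  define re where "re = (\<lambda>c. \<Sum>j\<in>J. Re (c j) *\<^sub>R u j)"
  define im where "im = (\<lambda>c. \<Sum>j\<in>J. Im (c j) *\<^sub>R u j)"
  obtain j where "j \<in> J" using J by blast
  then have \<tau>: "0 \<le> \<tau>" and hi: "0 \<le> hi"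
    using a[of j] lo by (auto simp: in_rectangle_def)
  have split: "(\<Sum>j\<in>J. c j * u j) = re c + \<i> * im c" for c
  proof -
    have "c j * u j = Re (c j) *\<^sub>R u j + \<i> * (Im (c j) *\<^sub>R u j)" for j
      by (subst complex_eq[of "c j"]) (simp add: scaleR_conv_of_real algebra_simps)
    then show ?thesis
      by (simp add: re_def im_def sum.distrib sum_distrib_left)
  qed
  have "0 < (\<Sum>j\<in>J. \<Sum>k\<in>J. inner (u j) (u k))"
    using J acute by (intro sum_pos) auto
  then have s: "0 < s\<^sup>2"
    using inner_sum_scaleR[of "\<lambda>_. 1" u J "\<lambda>_. 1"] by (simp add: s_def power2_norm_eq_inner)
  have re_bd: "norm (re c) \<le> hi * s" and im_bd: "norm (im c) \<le> \<tau> * s"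
    if "\<And>j. j \<in> J \<Longrightarrow> in_rectangle lo hi \<tau> (c j)" for c
  proof -
    have "\<bar>Re (c j)\<bar> \<le> hi" "\<bar>Im (c j)\<bar> \<le> \<tau>" if "j \<in> J" for j
      using \<open>\<And>j. j \<in> J \<Longrightarrow> in_rectangle lo hi \<tau> (c j)\<close>[OF that] lo
      by (auto simp: in_rectangle_def)
    then show "norm (re c) \<le> hi * s" "norm (im c) \<le> \<tau> * s"
      unfolding s_def re_def im_def using \<tau> hi acute' by (auto intro!: norm_sum_scaleR_le)
  qed
  have ra: "norm (re a) \<le> hi * s" and rb: "norm (re b) \<le> hi * s"
    and ia: "norm (im a) \<le> \<tau> * s" and ib: "norm (im b) \<le> \<tau> * s"
    using re_bd im_bd a b by blast+
  have cs: "- (norm x * norm y) \<le> inner x y" for x y :: complex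
    using Cauchy_Schwarz_ineq2[of x y] by linarith
  have prod_le: "norm x * norm y \<le> p * s * (q * s)" if "norm x \<le> p * s" "norm y \<le> q * s" "0 \<le> p"
    for x y :: complex and p q
    using that by (intro mult_mono) (auto simp: s_def)
  have "lo\<^sup>2 * s\<^sup>2 \<le> inner (re a) (re b)"
    unfolding s_def re_def using a b lo acute' 
    by (intro inner_sum_scaleR_ge) (auto simp: in_rectangle_def)
  moreover have "- (\<tau> * s * (\<tau> * s)) \<le> inner (\<i> * im a) (\<i> * im b)"
    using prod_le[OF ia ib \<tau>] cs[of "\<i> * im a" "\<i> * im b"]
    by (simp add: norm_mult)
  moreover have "- (hi * s * (\<tau> * s)) \<le> inner (re a) (\<i> * im b)"
    using prod_le[OF ra ib hi] cs[of "re a" "\<i> * im b"]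
    by (simp add: norm_mult)
  moreover have "- (\<tau> * s * (hi * s)) \<le> inner (\<i> * im a) (re b)"
    using prod_le[OF ia rb \<tau>] cs[of "\<i> * im a" "re b"]
    by (simp add: norm_mult)
  moreover have "(2 * hi * \<tau> + \<tau>\<^sup>2) * s\<^sup>2 < lo\<^sup>2 * s\<^sup>2"
    using dom s by simp
  ultimately show ?thesis
    by (simp add: split inner_add_left inner_add_right power2_eq_square algebra_simps)
qed

text \<open>
Two minors that omit different columns \<open>j\<close> and \<open>k\<close> share the columns \<open>D = C - {j, k}\<close>. Expanding
the first along \<open>k\<close> and the second along \<open>j\<close> writes both as combinations of the same
permanents \<open>block_permanent f (R - {i}) D\<close>. These omit different rows, so they form acute angles by
the induction hypothesis applied to the transpose.
\<close>
lemma block_permanents_acute: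
  fixes f :: "'a \<Rightarrow> 'a \<Rightarrow> complex"
  assumes lo: "0 < lo" and dom: "2 * hi * \<tau> + \<tau>\<^sup>2 < lo\<^sup>2"
    and "\<And>i j. i \<in> R \<Longrightarrow> j \<in> C \<Longrightarrow> in_rectangle lo hi \<tau> (f i j)"
    and "finite R" "card C = Suc (card R)" "j \<in> C" "k \<in> C"
  shows "0 < inner (block_permanent f R (C - {j})) (block_permanent f R (C - {k}))"
  using assms(3-)
proof (induction "card R" arbitrary: R C j k f)
  case 0
  then have "R = {}" "C = {j}" "k = j"
    by (auto simp: card_Suc_eq)
  then show ?case by (simp add: block_permanent_empty)
next
  case (Suc n)
  have C: "finite C" using Suc.prems by (metis card.infinite nat.distinct(1))
  have "\<exists>D j' k'. finite D \<and> card D = n \<and> j' \<notin> D \<and> k' \<notin> D \<and>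
    C - {j} = insert j' D \<and> C - {k} = insert k' D"
  proof (cases "j = k")
    case True
    \<comment> \<open>The two minors coincide, and any one of their columns can be used for the expansion.\<close>
    have "card (C - {j}) = Suc n"
      using Suc C by simp
    then obtain c D where "C - {j} = insert c D" "c \<notin> D" "card D = n"
      by (metis card_eq_SucD)
    then show ?thesis
      using True C by (metis finite_Diff finite_insert)
  next
    case False
    then show ?thesis
      using Suc C by (intro exI[of _ "C - {j, k}"] exI[of _ k] exI[of _ j]) auto
  qed
  then obtain D j' k' where D: "finite D" "card D = n" "j' \<notin> D" "k' \<notin> D"
    and Cj: "C - {j} = insert j' D" and Ck: "C - {k} = insert k' D"
    by blast
  have sub: "j' \<in> C" "k' \<in> C" "D \<subseteq> C"
    using Cj Ck by auto
  have "0 < inner (block_permanent f (R - {i}) D) (block_permanent f (R - {l}) D)"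
    if "i \<in> R" "l \<in> R" for i l
    using Suc.hyps(1)[of D R "\<lambda>i j. f j i" i l] Suc.hyps(2) Suc.prems(1,2) D that sub
    by (auto simp: block_permanent_transpose[of f] subset_iff)
  moreover have "R \<noteq> {}" using Suc.hyps by auto
  ultimately show ?case
    unfolding Cj Ck using Suc.prems D lo dom sub
    by (subst (1 2) block_permanent_expand_column) (auto intro!: acute_combinations)
qed

text \<open>
Expanding a column writes the permanent as a combination of pairwise acute minors. Its inner
product with itself is therefore positive.
\<close>
lemma block_permanent_nonzero:
  fixes f :: "'a \<Rightarrow> 'a \<Rightarrow> complex"
  assumes lo: "0 < lo" and dom: "2 * hi * \<tau> + \<tau>\<^sup>2 < lo\<^sup>2"
    and f: "\<And>i j. i \<in> R \<Longrightarrow> j \<in> C \<Longrightarrow> in_rectangle lo hi \<tau> (f i j)"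
    and R: "finite R" "finite C" "card C = card R"
  shows "block_permanent f R C \<noteq> 0"
proof (cases "R = {}")
  case True
  then show ?thesis using R by (simp add: block_permanent_empty)
next
  case False
  then obtain c D where C: "C = insert c D" "c \<notin> D"
    using R by (metis card_0_eq ex_in_conv mk_disjoint_insert)
  have "0 < inner (block_permanent f (R - {i}) D) (block_permanent f (R - {l}) D)"
    if "i \<in> R" "l \<in> R" for i l
    using block_permanents_acute[OF lo dom, of D R "\<lambda>i j. f j i" i l] f R C that
    by (auto simp: block_permanent_transpose[of f])
  then have "0 < inner (\<Sum>i\<in>R. f i c * block_permanent f (R - {i}) D)
      (\<Sum>i\<in>R. f i c * block_permanent f (R - {i}) D)"
    by (rule acute_combinations[OF R(1) False _ _ _ lo dom]) (use f C in auto)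
  then show ?thesis
    using R C by (auto simp: block_permanent_expand_column)
qed

section \<open>Polynomial functions of bounded degree\<close>

lemma mpoly_eval_superset:
  assumes "finite K" "Poly_Mapping.keys p \<subseteq> K"
  shows "mpoly_eval x p = (\<Sum>m\<in>K. Poly_Mapping.lookup p m *
    (\<Prod>v\<in>Poly_Mapping.keys m. x v ^ Poly_Mapping.lookup m v))"
  unfolding mpoly_eval_def using assms
  by (intro sum.mono_neutral_left) (auto simp: in_keys_iff)

lemma mpoly_eval_add: "mpoly_eval x (p + q) = mpoly_eval x p + mpoly_eval x q"
proof -
  let ?K = "Poly_Mapping.keys p \<union> Poly_Mapping.keys q"
  have "Poly_Mapping.keys (p + q) \<subseteq> ?K" by (rule Poly_Mapping.keys_add)
  then show ?thesis
    by (simp add: mpoly_eval_superset[of ?K] lookup_add distrib_right sum.distrib)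
qed

lemma mpoly_eval_single:
  "mpoly_eval x (Poly_Mapping.single m c) =
    c * (\<Prod>v\<in>Poly_Mapping.keys m. x v ^ Poly_Mapping.lookup m v)"
  by (subst mpoly_eval_superset[of "{m}"]) auto

lemma mpoly_degree_le_iff:
  "mpoly_degree p \<le> d \<longleftrightarrow>
    (\<forall>m\<in>Poly_Mapping.keys p. (\<Sum>v\<in>Poly_Mapping.keys m. Poly_Mapping.lookup m v) \<le> d)"
  by (simp add: mpoly_degree_def)

lemma prod_lookup_add_single:
  fixes x :: "'v \<Rightarrow> 'a::comm_semiring_1" and m :: "'v \<Rightarrow>\<^sub>0 nat"
  shows "(\<Prod>v\<in>Poly_Mapping.keys (m + Poly_Mapping.single w 1).
      x v ^ Poly_Mapping.lookup (m + Poly_Mapping.single w 1) v) =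
    x w * (\<Prod>v\<in>Poly_Mapping.keys m. x v ^ Poly_Mapping.lookup m v)"
proof -
  let ?K = "insert w (Poly_Mapping.keys m)"
  have "(\<Prod>v\<in>Poly_Mapping.keys (m + Poly_Mapping.single w 1).
      x v ^ Poly_Mapping.lookup (m + Poly_Mapping.single w 1) v) =
    (\<Prod>v\<in>?K. x v ^ Poly_Mapping.lookup (m + Poly_Mapping.single w 1) v)"
    using Poly_Mapping.keys_add[of m "Poly_Mapping.single w 1"]
    by (intro prod.mono_neutral_left) (auto simp: in_keys_iff)
  also have "\<dots> = (\<Prod>v\<in>?K. (if v = w then x v else 1) * x v ^ Poly_Mapping.lookup m v)"
    by (intro prod.cong) (auto simp: lookup_add lookup_single)
  also have "\<dots> = x w * (\<Prod>v\<in>?K. x v ^ Poly_Mapping.lookup m v)"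
    by (simp add: prod.distrib)
  also have "(\<Prod>v\<in>?K. x v ^ Poly_Mapping.lookup m v) =
      (\<Prod>v\<in>Poly_Mapping.keys m. x v ^ Poly_Mapping.lookup m v)"
    by (intro prod.mono_neutral_right) (auto simp: in_keys_iff)
  finally show ?thesis .
qed

lemma sum_lookup_add_single:
  fixes m :: "'v \<Rightarrow>\<^sub>0 nat"
  shows "(\<Sum>v\<in>Poly_Mapping.keys (m + Poly_Mapping.single w 1).
      Poly_Mapping.lookup (m + Poly_Mapping.single w 1) v) =
    Suc (\<Sum>v\<in>Poly_Mapping.keys m. Poly_Mapping.lookup m v)"
proof -
  let ?K = "insert w (Poly_Mapping.keys m)"
  have "(\<Sum>v\<in>Poly_Mapping.keys (m + Poly_Mapping.single w 1).
      Poly_Mapping.lookup (m + Poly_Mapping.single w 1) v) =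
    (\<Sum>v\<in>?K. Poly_Mapping.lookup (m + Poly_Mapping.single w 1) v)"
    using Poly_Mapping.keys_add[of m "Poly_Mapping.single w 1"]
    by (intro sum.mono_neutral_left) (auto simp: in_keys_iff)
  also have "\<dots> = (\<Sum>v\<in>?K. (if v = w then 1 else 0) + Poly_Mapping.lookup m v)"
    by (intro sum.cong) (auto simp: lookup_add lookup_single)
  also have "\<dots> = Suc (\<Sum>v\<in>?K. Poly_Mapping.lookup m v)"
    by (simp add: sum.distrib)
  also have "(\<Sum>v\<in>?K. Poly_Mapping.lookup m v) = (\<Sum>v\<in>Poly_Mapping.keys m. Poly_Mapping.lookup m v)"
    by (intro sum.mono_neutral_right) (auto simp: in_keys_iff)
  finally show ?thesis .
qed

text \<open>
The functions of degree at most \<open>d\<close> in the variables \<open>V\<close>, as sums of monomials whose variables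
are listed with repetition. On functions the product of two monomials is the concatenation of the
lists, so closure under multiplication needs no computation with polynomial mappings.
\<close>
inductive poly_fun :: "'v set \<Rightarrow> nat \<Rightarrow> (('v \<Rightarrow> 'a::comm_semiring_1) \<Rightarrow> 'a) \<Rightarrow> bool"
  for V :: "'v set" and d :: nat where
  monomial: "set vs \<subseteq> V \<Longrightarrow> length vs \<le> d \<Longrightarrow> poly_fun V d (\<lambda>x. c * prod_list (map x vs))"
| add: "poly_fun V d F \<Longrightarrow> poly_fun V d G \<Longrightarrow> poly_fun V d (\<lambda>x. F x + G x)"

lemma mpoly_of_monomial:
  fixes vs :: "'v list"
  shows "\<exists>m. Poly_Mapping.keys m \<subseteq> set vs \<and> (\<Sum>v\<in>Poly_Mapping.keys m. Poly_Mapping.lookup m v) = length vs \<and>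
    (\<forall>x. (\<Prod>v\<in>Poly_Mapping.keys m. x v ^ Poly_Mapping.lookup m v) =
      (prod_list (map x vs) :: 'a::comm_semiring_1))"
proof (induction vs)
  case Nil
  show ?case by (rule exI[of _ 0]) auto
next
  case (Cons w vs)
  then obtain m where m: "Poly_Mapping.keys m \<subseteq> set vs"
      "(\<Sum>v\<in>Poly_Mapping.keys m. Poly_Mapping.lookup m v) = length vs"
      "\<And>x. (\<Prod>v\<in>Poly_Mapping.keys m. x v ^ Poly_Mapping.lookup m v) =
      (prod_list (map x vs) :: 'a)"
    by blast
  show ?case
    using m Poly_Mapping.keys_add[of m "Poly_Mapping.single w 1"]
    by (intro exI[of _ "m + Poly_Mapping.single w 1"])
      (auto simp del: One_nat_def simp: sum_lookup_add_single prod_lookup_add_single)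
qed

lemma mpoly_of_poly_fun:
  fixes F :: "('v \<Rightarrow> 'a::comm_semiring_1) \<Rightarrow> 'a"
  assumes "poly_fun V d F"
  shows "\<exists>p. mpoly_vars p \<subseteq> V \<and> mpoly_degree p \<le> d \<and> (\<forall>x. mpoly_eval x p = F x)"
  using assms
proof induction
  case (monomial vs c)
  obtain m where m: "Poly_Mapping.keys m \<subseteq> set vs"
      "(\<Sum>v\<in>Poly_Mapping.keys m. Poly_Mapping.lookup m v) = length vs"
      "\<And>x. (\<Prod>v\<in>Poly_Mapping.keys m. x v ^ Poly_Mapping.lookup m v) =
      (prod_list (map x vs) :: 'a)"
    using mpoly_of_monomial[of vs, where 'a = 'a] by blast
  then show ?case
    using monomial by (intro exI[of _ "Poly_Mapping.single m c"])
      (auto simp: mpoly_vars_def mpoly_degree_def mpoly_eval_single)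
next
  case (add F G)
  then obtain p q where pq: "mpoly_vars p \<subseteq> V" "mpoly_degree p \<le> d" "\<forall>x. mpoly_eval x p = F x"
    "mpoly_vars q \<subseteq> V" "mpoly_degree q \<le> d" "\<forall>x. mpoly_eval x q = G x" by blast
  have "mpoly_vars (p + q) \<subseteq> V"
    using pq(1,4) Poly_Mapping.keys_add[of p q] unfolding mpoly_vars_def by blast
  moreover have "mpoly_degree (p + q) \<le> d"
    using pq(2,5) Poly_Mapping.keys_add[of p q] unfolding mpoly_degree_le_iff by blast
  ultimately show ?case
    using pq by (intro exI[of _ "p + q"]) (auto simp: mpoly_eval_add)
qed

lemma poly_fun_const: "poly_fun V d (\<lambda>x. c)"
  using poly_fun.monomial[of "[]" V d c] by simp

lemma poly_fun_var: "v \<in> V \<Longrightarrow> 1 \<le> d \<Longrightarrow> poly_fun V d (\<lambda>x. x v)"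
  using poly_fun.monomial[of "[v]" V d 1] by simp

lemma poly_fun_mult:
  assumes "poly_fun V d F" "poly_fun V e G"
  shows "poly_fun V (d + e) (\<lambda>x. F x * G x)"
  using assms(1)
proof induction
  case mon: (monomial vs c)
  show ?case
    using assms(2)
  proof induction
    case (monomial ws b)
    then show ?case
      using mon poly_fun.monomial[of "vs @ ws" V "d + e" "c * b"] by (simp add: ac_simps)
  next
    case (add G1 G2)
    then show ?case by (simp add: distrib_left poly_fun.add)
  qed
next
  case (add F1 F2)
  then show ?case by (simp add: distrib_right poly_fun.add)
qed

lemma poly_fun_mono: "poly_fun V d F \<Longrightarrow> d \<le> e \<Longrightarrow> poly_fun V e F"
  by (induction rule: poly_fun.induct) (auto intro: poly_fun.intros)

lemma poly_fun_sum: "(\<And>i. i \<in> I \<Longrightarrow> poly_fun V d (F i)) \<Longrightarrow> poly_fun V d (\<lambda>x. \<Sum>i\<in>I. F i x)"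
  by (induction I rule: infinite_finite_induct) (auto intro: poly_fun.add poly_fun_const)

lemma poly_fun_scale: "poly_fun V d F \<Longrightarrow> poly_fun V d (\<lambda>x. c * F x)"
  using poly_fun_mult[OF poly_fun_const[of V 0 c]] by simp

lemma poly_fun_diff:
  fixes F G :: "('v \<Rightarrow> 'a::comm_ring_1) \<Rightarrow> 'a"
  assumes "poly_fun V d F" "poly_fun V d G" shows "poly_fun V d (\<lambda>x. F x - G x)"
  using poly_fun.add[OF assms(1) poly_fun_scale[OF assms(2), of "-1"]] by simp

text \<open>
This is the weighting in which the auxiliary variable of the polynomial has weight one: the
coefficient of the \<open>k\<close>-th power depends on the parameters \<open>x\<close> with degree at most \<open>k\<close>.
\<close>
definition graded :: "'v set \<Rightarrow> (('v \<Rightarrow> 'a::comm_semiring_1) \<Rightarrow> 'a poly) \<Rightarrow> bool" where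
  "graded V P \<longleftrightarrow> (\<forall>k. poly_fun V k (\<lambda>x. coeff (P x) k))"

lemma graded_const: "graded V (\<lambda>x. p)"
  by (simp add: graded_def poly_fun_const)

lemma graded_sum: "(\<And>i. i \<in> I \<Longrightarrow> graded V (P i)) \<Longrightarrow> graded V (\<lambda>x. \<Sum>i\<in>I. P i x)"
  by (simp add: graded_def coeff_sum poly_fun_sum)

lemma graded_mult: 
  assumes "graded V P" "graded V Q"
  shows "graded V (\<lambda>x. P x * Q x)"
  unfolding graded_def
proof
  fix k
  have "poly_fun V k (\<lambda>x. coeff (P x) i * coeff (Q x) (k - i))" if "i \<le> k" for i
    using poly_fun_mult[of V i _ "k - i"] assms that unfolding graded_def by fastforce
  then show "poly_fun V k (\<lambda>x. coeff (P x * Q x) k)"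
    unfolding coeff_mult by (intro poly_fun_sum) simp
qed

lemma graded_prod: "(\<And>i. i \<in> I \<Longrightarrow> graded V (P i)) \<Longrightarrow> graded V (\<lambda>x. \<Prod>i\<in>I. P i x)"
  by (induction I rule: infinite_finite_induct) (auto intro: graded_mult graded_const)

section \<open>Logarithms of polynomials\<close>

text \<open>
The power series of the derivative of \<open>ln p\<close> at 0. Its coefficients, divided by the exponent, are
the Taylor coefficients of \<open>ln p\<close>.
\<close>
definition log_deriv :: "'a::field poly \<Rightarrow> 'a fps" where
  "log_deriv p = fps_deriv (fps_of_poly p) * inverse (fps_of_poly p)"

lemma fps_of_poly_mult_log_deriv:
  "coeff p 0 \<noteq> 0 \<Longrightarrow> fps_of_poly p * log_deriv p = fps_deriv (fps_of_poly p)"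
  unfolding log_deriv_def by (simp add: mult.left_commute[of _ "fps_deriv _"] inverse_mult_eq_1')

text \<open>
Comparing coefficients in \<open>p * (p' / p) = p'\<close> gives a recursion for the coefficients of the
logarithmic derivative. It divides only by the constant coefficient, which is the same for all \<open>x\<close>,
so no denominators depending on \<open>x\<close> appear and the weights add up.
\<close>
lemma poly_fun_log_deriv:
  fixes P :: "('v \<Rightarrow> 'a::field) \<Rightarrow> 'a poly"
  assumes "graded V P" and c: "\<And>x. coeff (P x) 0 = c" "c \<noteq> 0"
  shows "poly_fun V (Suc k) (\<lambda>x. fps_nth (log_deriv (P x)) k)"
proof (induction k rule: less_induct)
  case (less k)
  have "fps_nth (log_deriv (P x)) k = (1 / c) * (of_nat (Suc k) * coeff (P x) (Suc k) -
      (\<Sum>i=1..k. coeff (P x) i * fps_nth (log_deriv (P x)) (k - i)))" for x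
  proof -
    have "fps_nth (fps_of_poly (P x) * log_deriv (P x)) k = of_nat (Suc k) * coeff (P x) (Suc k)"
      using c by (subst fps_of_poly_mult_log_deriv) auto
    moreover have "fps_nth (fps_of_poly (P x) * log_deriv (P x)) k =
        (\<Sum>i=0..k. coeff (P x) i * fps_nth (log_deriv (P x)) (k - i))"
      by (simp add: fps_mult_nth)
    moreover have "\<dots> = c * fps_nth (log_deriv (P x)) k +
        (\<Sum>i=1..k. coeff (P x) i * fps_nth (log_deriv (P x)) (k - i))"
      by (simp add: sum.atLeast_Suc_atMost c)
    ultimately show ?thesis
      using c(2) by (simp add: field_simps)
  qed
  moreover have "poly_fun V (Suc k) (\<lambda>x. coeff (P x) i * fps_nth (log_deriv (P x)) (k - i))"
    if "i \<in> {1..k}" for i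
    using poly_fun_mult[of V i _ "Suc (k - i)"] less.IH[of "k - i"] assms(1) that
    unfolding graded_def by fastforce
  ultimately show ?case
    using assms(1) unfolding graded_def
    by (simp only:) (intro poly_fun_scale poly_fun_diff poly_fun_sum; simp)
qed

abbreviation complexify :: "real poly \<Rightarrow> complex poly" where
  "complexify \<equiv> map_poly of_real"

lemma complexify_add: "complexify (p + q) = complexify p + complexify q"
  by (rule poly_eqI) (simp add: coeff_map_poly)

lemma complexify_mult: "complexify (p * q) = complexify p * complexify q"
  by (rule poly_eqI) (simp add: coeff_map_poly coeff_mult)

lemma complexify_sum: "complexify (\<Sum>i\<in>I. p i) = (\<Sum>i\<in>I. complexify (p i))"
  by (induction I rule: infinite_finite_induct) (auto simp: complexify_add)

lemma complexify_prod: "complexify (\<Prod>i\<in>I. p i) = (\<Prod>i\<in>I. complexify (p i))"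
  by (induction I rule: infinite_finite_induct) (auto simp: complexify_mult map_poly_1)

lemma complexify_monom: "complexify (monom c k) = monom (of_real c) k"
  by (rule map_poly_monom) simp

lemma poly_complexify:
  "poly (complexify p) (of_real x) = of_real (poly p x)"
  by (induction p) (auto simp: map_poly_pCons)

lemma Ln_one_minus_truncation:
  fixes w :: complex
  assumes w: "norm w \<le> q" and q: "q < 1"
  shows "norm (Ln (1 - w) + (\<Sum>k=1..m. w ^ k / of_nat k)) \<le> q ^ Suc m / (1 - q)"
proof -
  have q0: "0 \<le> q" using w norm_ge_zero order_trans by blast
  have "(\<lambda>k. - (w ^ k / of_nat k)) sums Ln (1 - w)"
    using Ln_series'[of "- w"] w q by simp
  from sums_minus[OF this] have "(\<lambda>k. w ^ k / of_nat k) sums (- Ln (1 - w))"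
    by simp
  from sums_split_initial_segment[OF this, of "Suc m"]
  have tail: "(\<lambda>k. w ^ (k + Suc m) / of_nat (k + Suc m)) sums
      (- Ln (1 - w) - (\<Sum>k<Suc m. w ^ k / of_nat k))" .
  have "(\<Sum>k<Suc m. w ^ k / of_nat k) = (\<Sum>k=1..m. w ^ k / of_nat k)"
    by (intro sum.mono_neutral_right) auto
  with tail have tail: "(\<lambda>k. w ^ (k + Suc m) / of_nat (k + Suc m)) sums
      - (Ln (1 - w) + (\<Sum>k=1..m. w ^ k / of_nat k))"
    by simp
  have geo: "(\<lambda>k. q ^ Suc m * q ^ k) sums (q ^ Suc m * (1 / (1 - q)))"
    using q q0 by (intro sums_mult geometric_sums) auto
  have "norm (- (Ln (1 - w) + (\<Sum>k=1..m. w ^ k / of_nat k))) \<le> q ^ Suc m * (1 / (1 - q))"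
  proof (rule norm_sums_le[OF tail geo])
    fix k
    have "norm (w ^ (k + Suc m) / of_nat (k + Suc m)) \<le> norm w ^ (k + Suc m) / 1"
      unfolding norm_divide norm_power norm_of_nat by (intro divide_left_mono) auto
    also have "\<dots> \<le> q ^ Suc m * q ^ k"
      using power_mono[OF w, of "k + Suc m"] by (simp add: power_add mult_ac)
    finally show "norm (w ^ (k + Suc m) / of_nat (k + Suc m)) \<le> q ^ Suc m * q ^ k" .
  qed
  then show ?thesis unfolding norm_minus_cancel by simp
qed

lemma coeff_prod_list_one_minus:
  fixes xs :: "'a::comm_ring_1 list"
  shows "coeff (\<Prod>x\<leftarrow>xs. [:1, - x:]) 0 = 1"
  by (induction xs) (auto simp: coeff_mult)

text \<open>
Normalising at 0 instead of at infinity: the list contains the inverses of the roots, so that each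
factor contributes a term \<open>Ln (1 - x)\<close> to the logarithm of the value at 1.
\<close>
lemma complex_poly_factor_inverse_roots:
  fixes p :: "complex poly"
  assumes p0: "coeff p 0 \<noteq> 0"
  shows "\<exists>xs. length xs = degree p \<and> (\<forall>x\<in>set xs. x \<noteq> 0 \<and> poly p (1 / x) = 0) \<and>
    p = smult (coeff p 0) (\<Prod>x\<leftarrow>xs. [:1, - x:])"
proof -
  have "p \<noteq> 0" using p0 by auto
  then obtain A where A: "size A = degree p"
    "p = smult (lead_coeff p) (\<Prod>x\<in>#A. [:- x, 1:])"
    using alg_closed_imp_factorization by blast
  obtain rs where rs: "mset rs = A" by (metis ex_mset)
  define a where "a = lead_coeff p"
  have p: "p = smult a (\<Prod>r\<leftarrow>rs. [:- r, 1:])"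
    using A(2) rs unfolding a_def by (metis mset_map prod_mset_prod_list)
  have root: "poly p r = 0" if "r \<in> set rs" for r
  proof -
    have "poly (\<Prod>r\<leftarrow>rs. [:- r, 1:]) r = 0" using that by (induction rs) auto
    then show ?thesis by (subst p) simp
  qed
  have r0: "r \<noteq> 0" if "r \<in> set rs" for r
    using root[OF that] p0 by (auto simp: poly_0_coeff_0)
  have "(\<Prod>r\<leftarrow>rs. [:- r, 1:]) = smult (\<Prod>r\<leftarrow>rs. - r) (\<Prod>x\<leftarrow>map (\<lambda>r. 1 / r) rs. [:1, - x:])"
    using r0
  proof (induction rs)
    case (Cons r rs)
    then have "[:- r, 1:] = smult (- r) [:1, - (1 / r):]" by simp
    moreover have "(\<Prod>r\<leftarrow>rs. [:- r, 1:]) =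
        smult (\<Prod>r\<leftarrow>rs. - r) (\<Prod>x\<leftarrow>map (\<lambda>r. 1 / r) rs. [:1, - x:])"
      using Cons by simp
    ultimately show ?case
      by (simp only: list.map prod_list.Cons mult_smult_left mult_smult_right smult_smult
          mult.commute[of "- r"])
  qed simp
  then have "p = smult (a * (\<Prod>r\<leftarrow>rs. - r)) (\<Prod>x\<leftarrow>map (\<lambda>r. 1 / r) rs. [:1, - x:])"
    by (subst p) (simp only: smult_smult)
  then obtain b where b: "p = smult b (\<Prod>x\<leftarrow>map (\<lambda>r. 1 / r) rs. [:1, - x:])"
    by blast
  define xs where "xs = map (\<lambda>r. 1 / r) rs"
  have p_xs: "p = smult b (\<Prod>x\<leftarrow>xs. [:1, - x:])"
    using b unfolding xs_def .
  then have "coeff p 0 = b * coeff (\<Prod>x\<leftarrow>xs. [:1, - x:]) 0"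
    by (metis coeff_smult)
  then have "coeff p 0 = b" by (simp add: coeff_prod_list_one_minus)
  moreover have "length xs = degree p"
    using A(1) rs by (auto simp: xs_def)
  moreover have "\<forall>x\<in>set xs. x \<noteq> 0 \<and> poly p (1 / x) = 0"
    using r0 root by (auto simp: xs_def)
  ultimately show ?thesis using p_xs by blast
qed

text \<open>
The logarithmic derivative turns the product into a sum, and a single factor \<open>1 - x * X\<close>
contributes the geometric series with coefficients \<open>- (x ^ Suc k)\<close>. In terms of power sums these
are Newton's identities.
\<close>
lemma log_deriv_prod_list:
  fixes xs :: "'a::field list"
  shows "fps_of_poly (\<Prod>x\<leftarrow>xs. [:1, - x:]) * Abs_fps (\<lambda>k. - (\<Sum>x\<leftarrow>xs. x ^ Suc k)) =
    fps_deriv (fps_of_poly (\<Prod>x\<leftarrow>xs. [:1, - x:]))"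
proof (induction xs)
  case Nil
  show ?case by (simp add: fps_zero_def[symmetric])
next
  case (Cons x xs)
  define P where "P = fps_of_poly (\<Prod>x\<leftarrow>xs. [:1, - x:])"
  define S where "S = Abs_fps (\<lambda>k. - (\<Sum>x\<leftarrow>xs. x ^ Suc k))"
  define L where "L = fps_of_poly [:1, - x:]"
  have L: "L = 1 - fps_const x * fps_X"
    by (simp add: L_def fps_of_poly_pCons mult.commute)
  have "L * Abs_fps (\<lambda>k. - (x ^ Suc k)) = - fps_const x"
  proof (rule fps_ext)
    fix n
    show "fps_nth (L * Abs_fps (\<lambda>k. - (x ^ Suc k))) n = fps_nth (- fps_const x) n"
      unfolding L by (cases n) (simp_all add: algebra_simps mult.assoc)
  qed
  then have 1: "L * Abs_fps (\<lambda>k. - (x ^ Suc k)) = fps_deriv L"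
    by (simp add: L)
  have "Abs_fps (\<lambda>k. - (\<Sum>x\<leftarrow>x # xs. x ^ Suc k)) = Abs_fps (\<lambda>k. - (x ^ Suc k)) + S"
    by (rule fps_ext) (simp add: S_def)
  then have "fps_of_poly (\<Prod>x\<leftarrow>x # xs. [:1, - x:]) * Abs_fps (\<lambda>k. - (\<Sum>x\<leftarrow>x # xs. x ^ Suc k)) =
      (L * P) * (Abs_fps (\<lambda>k. - (x ^ Suc k)) + S)"
    by (simp add: L_def P_def fps_of_poly_mult del: mult_pCons_left)
  also have "\<dots> = (L * Abs_fps (\<lambda>k. - (x ^ Suc k))) * P + L * (P * S)"
    by (simp add: algebra_simps)
  also have "P * S = fps_deriv P"
    using Cons.IH unfolding P_def S_def .
  also have "L * Abs_fps (\<lambda>k. - (x ^ Suc k)) * P + L * fps_deriv P = fps_deriv (L * P)"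
    unfolding 1 by (simp add: add.commute)
  finally show ?case
    by (simp add: L_def P_def fps_of_poly_mult del: mult_pCons_left)
qed

text \<open>
Over the complex numbers the coefficients are power sums of the inverse roots; this identity brings
them back to the real series, from which the approximating polynomial is made.
\<close>
lemma log_deriv_complexify:
  fixes p :: "real poly"
  assumes "coeff p 0 \<noteq> 0"
  shows "log_deriv (complexify p) = Abs_fps (\<lambda>k. of_real (fps_nth (log_deriv p) k))"
proof -
  let ?P = "fps_of_poly (complexify p)"
  have c: "coeff (complexify p) k = of_real (coeff p k)" for k
    by (simp add: coeff_map_poly)
  have "?P * Abs_fps (\<lambda>k. of_real (fps_nth (log_deriv p) k)) = fps_deriv ?P"
  proof (rule fps_ext)
    fix n
    have "fps_nth (?P * Abs_fps (\<lambda>k. of_real (fps_nth (log_deriv p) k))) n =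
        of_real (fps_nth (fps_of_poly p * log_deriv p) n)"
      by (simp add: fps_mult_nth c)
    also have "\<dots> = fps_nth (fps_deriv ?P) n"
      using assms by (simp add: fps_of_poly_mult_log_deriv c)
    finally show "fps_nth (?P * Abs_fps (\<lambda>k. of_real (fps_nth (log_deriv p) k))) n =
      fps_nth (fps_deriv ?P) n" .
  qed
  moreover have "?P * log_deriv (complexify p) = fps_deriv ?P"
    using assms by (intro fps_of_poly_mult_log_deriv) (simp add: c)
  moreover have "?P \<noteq> 0"
  proof
    assume "?P = 0"
    then have "fps_nth ?P 0 = 0" by (simp only: fps_zero_nth)
    with assms show False by (simp add: c)
  qed
  ultimately show ?thesis by (metis mult_left_cancel)
qed

lemma log_deriv_eq_power_sums:
  fixes p :: "'a::field poly"
  assumes c: "c \<noteq> 0" and p: "p = smult c (\<Prod>x\<leftarrow>xs. [:1, - x:])"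
  shows "fps_nth (log_deriv p) k = - (\<Sum>x\<leftarrow>xs. x ^ Suc k)"
proof -
  let ?S = "Abs_fps (\<lambda>k. - (\<Sum>x\<leftarrow>xs. x ^ Suc k))"
  have p0: "coeff p 0 \<noteq> 0" using c by (simp add: p coeff_prod_list_one_minus)
  have "fps_of_poly p * ?S = fps_deriv (fps_of_poly p)"
    using log_deriv_prod_list[of xs] by (simp add: p fps_of_poly_smult mult.assoc)
  also have "\<dots> = fps_of_poly p * log_deriv p"
    using p0 by (simp add: fps_of_poly_mult_log_deriv)
  finally have "?S = log_deriv p" 
    using p0 by auto
  then show ?thesis by (metis fps_nth_Abs_fps)
qed

text \<open>
Factoring \<open>p\<close> over the complex numbers splits \<open>ln \<bar>p(1)\<bar>\<close> into one term \<open>ln \<bar>1 - x\<bar>\<close> for each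
inverse root \<open>x\<close>, where \<open>\<bar>x\<bar> \<le> 1 / \<beta>\<close>. The series of each term is truncated separately, so the error
is only linear in the degree; the power sums that remain are the coefficients of the logarithmic
derivative.
\<close>
lemma ln_poly_truncation:
  fixes p :: "real poly"
  assumes \<beta>: "1 < \<beta>"
    and nz: "\<And>z. norm z \<le> \<beta> \<Longrightarrow> poly (complexify p) z \<noteq> 0"
  shows "\<bar>ln \<bar>poly p 1\<bar> - (ln \<bar>coeff p 0\<bar> + (\<Sum>k=1..m. fps_nth (log_deriv p) (k - 1) / real k))\<bar>
    \<le> real (degree p) * ((1 / \<beta>) ^ Suc m / (1 - 1 / \<beta>))"
proof -
  let ?P = "complexify p"
  have c: "coeff ?P k = of_real (coeff p k)" for k
    by (simp add: coeff_map_poly)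
  have P0: "coeff ?P 0 \<noteq> 0" using nz[of 0] \<beta> by (simp add: poly_0_coeff_0)
  then have p0: "coeff p 0 \<noteq> 0" using c by simp
  from complex_poly_factor_inverse_roots[OF P0] obtain xs where xs: "length xs = degree ?P"
    and root: "\<And>x. x \<in> set xs \<Longrightarrow> x \<noteq> 0 \<and> poly ?P (1 / x) = 0"
    and P: "?P = smult (coeff ?P 0) (\<Prod>x\<leftarrow>xs. [:1, - x:])"
    by blast
  have deg: "degree ?P = degree p" by (rule degree_map_poly) auto
  have small: "norm x \<le> 1 / \<beta>" if "x \<in> set xs" for x
    using nz[of "1 / x"] root[OF that] \<beta> by (force simp: norm_divide field_simps not_le)
  have \<beta>': "1 / \<beta> < 1" using \<beta> by simp
  have power_sum: "of_real (fps_nth (log_deriv p) k) = - (\<Sum>x\<leftarrow>xs. x ^ Suc k)" for k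
    using log_deriv_eq_power_sums[OF P0 P, of k] log_deriv_complexify[OF p0] by simp
  have L: "fps_nth (log_deriv p) k = - (\<Sum>x\<leftarrow>xs. Re (x ^ Suc k))" for k
  proof -
    have "Re (\<Sum>x\<leftarrow>xs. x ^ Suc k) = (\<Sum>x\<leftarrow>xs. Re (x ^ Suc k))"
      by (induction xs) auto
    then show ?thesis
      using power_sum[of k]
      by (metis Re_complex_of_real uminus_complex.sel(1))
  qed
  have at1: "of_real (poly p 1) = of_real (coeff p 0) * (\<Prod>x\<leftarrow>xs. 1 - x)"
  proof -
    have "of_real (poly p 1) = poly ?P 1" 
      using poly_complexify[of p 1] by simp
    also have "\<dots> = of_real (coeff p 0) * (\<Prod>x\<leftarrow>xs. 1 - x)"
    proof -
      have "poly (\<Prod>x\<leftarrow>xs. [:1, - x:]) 1 = (\<Prod>x\<leftarrow>xs. 1 - x)"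
        by (induction xs) (auto simp: left_diff_distrib)
      then show ?thesis by (subst P) (simp add: c)
    qed
    finally show ?thesis .
  qed
  have "norm (\<Prod>x\<leftarrow>xs. 1 - x) = (\<Prod>x\<leftarrow>xs. norm (1 - x))"
    by (induction xs) (auto simp: norm_mult)
  then have "\<bar>poly p 1\<bar> = \<bar>coeff p 0\<bar> * (\<Prod>x\<leftarrow>xs. norm (1 - x))"
    using at1 by (metis norm_mult norm_of_real)
  moreover have "ln (\<Prod>x\<leftarrow>xs. norm (1 - x)) = (\<Sum>x\<leftarrow>xs. Re (Ln (1 - x)))
    \<and> (\<Prod>x\<leftarrow>xs. norm (1 - x)) > 0"
    using small
  proof (induction xs)
    case (Cons x xs)
    then have "1 - x \<noteq> 0" using \<beta>' by force
    then show ?case using Cons by (simp add: ln_mult)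
  qed simp
  ultimately have "ln \<bar>poly p 1\<bar> = ln \<bar>coeff p 0\<bar> + (\<Sum>x\<leftarrow>xs. Re (Ln (1 - x)))"
    using p0 by (simp add: ln_mult)
  moreover have "(\<Sum>k=1..m. fps_nth (log_deriv p) (k - 1) / real k) =
      - (\<Sum>x\<leftarrow>xs. \<Sum>k=1..m. Re (x ^ k) / real k)"
    unfolding L
    by (induction xs) (simp_all add: sum.distrib add_divide_distrib sum_negf diff_divide_distrib sum_subtractf)
  moreover have "\<bar>(\<Sum>x\<leftarrow>xs. Re (Ln (1 - x))) + (\<Sum>x\<leftarrow>xs. \<Sum>k=1..m. Re (x ^ k) / real k)\<bar>
      \<le> real (length xs) * ((1 / \<beta>) ^ Suc m / (1 - 1 / \<beta>))"
    using small
  proof (induction xs)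
    case (Cons x xs)
    have "\<bar>Re (Ln (1 - x) + (\<Sum>k=1..m. x ^ k / of_nat k))\<bar> \<le> (1 / \<beta>) ^ Suc m / (1 - 1 / \<beta>)"
      using Cons.prems by (intro order_trans[OF abs_Re_le_cmod Ln_one_minus_truncation] \<beta>') auto
    moreover have "Re (Ln (1 - x) + (\<Sum>k=1..m. x ^ k / of_nat k)) = 
       Re (Ln (1 - x)) + (\<Sum>k=1..m. Re (x ^ k) / real k)"
      by (simp add: Re_divide_of_nat)
    moreover have "\<bar>(\<Sum>x\<leftarrow>xs. Re (Ln (1 - x))) + (\<Sum>x\<leftarrow>xs. \<Sum>k=1..m. Re (x ^ k) / real k)\<bar>
      \<le> real (length xs) * ((1 / \<beta>) ^ Suc m / (1 - 1 / \<beta>))"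
      using Cons by simp
    ultimately show ?case
      by (simp add: distrib_right) argo
  qed simp
  ultimately show ?thesis
    using xs deg by simp
qed

section \<open>A polynomial map from a disc into a neighbourhood of the unit interval\<close>

text \<open>
Take \<open>r = \<rho> / 4\<close>. The function \<open>\<psi>(z) = - r * Ln (1 - \<alpha> * z)\<close> vanishes at 0 and equals 1 at 1 by the
choice of \<open>\<alpha>\<close>. On discs in which \<open>1 - \<alpha> * z\<close> stays in the right half-plane, its imaginary part is
bounded by \<open>r * pi / 2\<close>. Its real part is at least \<open>- r * ln 2\<close> where \<open>\<bar>1 - \<alpha> * z\<bar> \<le> 2\<close>, and it exceeds 1 only slightly as long as \<open>1 - \<alpha> * z\<close> does not
come much closer to 0 than \<open>1 - \<alpha>\<close>. A Taylor polynomial inherits this up to a small error, and a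
small multiple of \<open>z\<close> restores the value 1 at 1.
\<close>
lemma polynomial_disc_to_strip:
  fixes \<rho> :: real
  assumes \<rho>: "0 < \<rho>"
  shows "\<exists>\<phi> \<beta>. 1 < \<beta> \<and> coeff \<phi> 0 = 0 \<and> poly \<phi> 1 = 1 \<and>
    (\<forall>z. norm z \<le> \<beta> \<longrightarrow> - \<rho> \<le> Re (poly (complexify \<phi>) z) \<and>
      Re (poly (complexify \<phi>) z) \<le> 1 + \<rho> \<and> \<bar>Im (poly (complexify \<phi>) z)\<bar> \<le> \<rho>)"
proof -
  define r where "r = \<rho> / 4"
  define \<alpha> where "\<alpha> = 1 - exp (- 1 / r)"
  define q where "q = 1 - exp (- 1 / r - 1)"
  \<comment> \<open>\<open>1 - q\<close> is smaller than \<open>1 - \<alpha>\<close> by the factor \<open>exp (- 1)\<close>, so \<open>\<psi>\<close> grows by at most \<open>r\<close> beyond 1.\<close>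
  define \<beta> where "\<beta> = q / \<alpha>"
  have r: "0 < r" using \<rho> by (simp add: r_def)
  have \<alpha>: "0 < \<alpha>" using r by (simp add: \<alpha>_def)
  have "\<alpha> < q" by (simp add: \<alpha>_def q_def)
  then have \<beta>: "1 < \<beta>" using \<alpha> by (simp add: \<beta>_def)
  have q: "0 < q" "q < 1" using \<alpha> \<open>\<alpha> < q\<close> by (linarith, simp add: q_def)
  have "\<exists>m. q ^ m < \<rho> / 2 * (1 - q) / (r * (1 + \<beta>))"
    using \<rho> r q \<beta> by (intro real_arch_pow_inv divide_pos_pos mult_pos_pos) auto
  then obtain m where m: "q ^ m < \<rho> / 2 * (1 - q) / (r * (1 + \<beta>))" by blast
  define \<eta> where "\<eta> = r * (q ^ Suc m / (1 - q))"
  have "q ^ Suc m \<le> q ^ m" using q by (simp add: mult_left_le_one_le)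
  also note m
  finally have "q ^ Suc m * (r * (1 + \<beta>)) < \<rho> / 2 * (1 - q)"
    using r \<beta> by (subst (asm) pos_less_divide_eq) auto
  then have "q ^ Suc m * (r * (1 + \<beta>)) / (1 - q) \<le> \<rho> / 2"
    using q by (subst pos_divide_le_eq) auto
  moreover have "\<eta> * (1 + \<beta>) = q ^ Suc m * (r * (1 + \<beta>)) / (1 - q)"
    by (simp add: \<eta>_def)
  ultimately have "\<eta> * (1 + \<beta>) \<le> \<rho> / 2" by simp
  then have \<eta>: "\<eta> + \<eta> * \<beta> \<le> \<rho> / 2" by (simp add: distrib_left)
  define S where "S = (\<lambda>z::complex. of_real r * (\<Sum>k=1..m. (of_real \<alpha> * z) ^ k / of_nat k))"
  define \<psi> where "\<psi> = (\<lambda>z::complex. - of_real r * Ln (1 - of_real \<alpha> * z))"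
  define c where "c = 1 - r * (\<Sum>k=1..m. \<alpha> ^ k / real k)"
  define \<phi> where "\<phi> = (\<Sum>k=1..m. monom (r * \<alpha> ^ k / real k) k) + monom c 1"
  have \<alpha>z: "norm (of_real \<alpha> * z) \<le> q" if "norm z \<le> \<beta>" for z :: complex
    using that \<alpha> by (simp add: norm_mult \<beta>_def field_simps)
  have S: "norm (S z - \<psi> z) \<le> \<eta>" if "norm z \<le> \<beta>" for z
  proof -
    have "S z - \<psi> z = of_real r * (Ln (1 - of_real \<alpha> * z) + (\<Sum>k=1..m. (of_real \<alpha> * z) ^ k / of_nat k))"
      by (simp add: S_def \<psi>_def algebra_simps)
    then have "norm (S z - \<psi> z) =
        r * norm (Ln (1 - of_real \<alpha> * z) + (\<Sum>k=1..m. (of_real \<alpha> * z) ^ k / of_nat k))"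
      using r by (simp only: norm_mult norm_of_real abs_of_pos)
    also have "\<dots> \<le> \<eta>"
      unfolding \<eta>_def using r
      by (intro mult_left_mono Ln_one_minus_truncation[OF \<alpha>z[OF that] q(2)]) auto
    finally show ?thesis .
  qed
  have "\<psi> 1 = 1"
  proof -
    have "1 - complex_of_real \<alpha> = of_real (exp (- 1 / r))" by (simp add: \<alpha>_def)
    then have "Ln (1 - complex_of_real \<alpha>) = of_real (- 1 / r)"
      by (simp only: Ln_of_real[OF exp_gt_zero] ln_exp)
    then show ?thesis using r by (simp add: \<psi>_def)
  qed
  moreover have "S 1 = of_real (1 - c)"
    by (simp add: S_def c_def)
  ultimately have "norm (complex_of_real (1 - c) - 1) \<le> \<eta>"
    using S[of 1] \<beta> by simp
  then have c: "\<bar>c\<bar> \<le> \<eta>"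
    by simp
  have \<phi>: "poly (complexify \<phi>) z = S z + of_real c * z" for z
    by (simp add: \<phi>_def S_def complexify_add complexify_sum complexify_monom poly_sum poly_monom
        sum_distrib_left power_mult_distrib mult_ac)
  have close: "norm (poly (complexify \<phi>) z - \<psi> z) \<le> \<rho> / 2" if "norm z \<le> \<beta>" for z
  proof -
    have "norm (of_real c * z) \<le> \<eta> * \<beta>"
      unfolding norm_mult using c that by (intro mult_mono) auto
    then have "norm ((S z - \<psi> z) + of_real c * z) \<le> \<eta> + \<eta> * \<beta>"
      using S[OF that] by (intro norm_triangle_mono) auto
    then show ?thesis using \<eta> by (simp add: \<phi> algebra_simps)
  qed
  have strip: "- r \<le> Re (\<psi> z)" "Re (\<psi> z) \<le> 1 + r" "\<bar>Im (\<psi> z)\<bar> \<le> 2 * r" if "norm z \<le> \<beta>" for z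
  proof -
    define w where "w = 1 - of_real \<alpha> * z"
    have "\<bar>Re (of_real \<alpha> * z)\<bar> \<le> q"
      using \<alpha>z[OF that] abs_Re_le_cmod order_trans by blast
    then have Re: "1 - q \<le> Re w" by (auto simp: w_def)
    then have w0: "w \<noteq> 0" and Re0: "0 < Re w" using q by auto
    have w_ge: "1 - q \<le> norm w" using Re complex_Re_le_cmod order_trans by blast
    have "norm w \<le> 1 + norm (of_real \<alpha> * z)"
      unfolding w_def by (metis norm_one norm_triangle_ineq4)
    then have w_le: "norm w \<le> 2" using \<alpha>z[OF that] q by linarith
    have "ln (norm w) \<le> ln 2" using w_le w0 by simp
    also have "\<dots> \<le> (1::real)" using ln_le_minus_one[of "2::real"] by simp
    finally have "r * ln (norm w) \<le> r * 1" using r by (intro mult_left_mono) auto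
    moreover have \<psi>: "Re (\<psi> z) = - (r * ln (norm w))" using w0 by (simp add: \<psi>_def flip: w_def)
    ultimately show "- r \<le> Re (\<psi> z)" by simp
    have "- 1 / r - 1 = ln (1 - q)" by (simp add: q_def)
    also have "\<dots> \<le> ln (norm w)" using w_ge q w0 by simp
    finally have "r * (- 1 / r - 1) \<le> r * ln (norm w)" using r by (intro mult_left_mono) auto
    then show "Re (\<psi> z) \<le> 1 + r" using r by (simp add: \<psi> algebra_simps)
    have "\<bar>Im (Ln w)\<bar> < pi / 2" using Re_Ln_pos_lt[OF w0] Re0 by simp
    then have "\<bar>Im (Ln w)\<bar> \<le> 2" using pi_less_4 by linarith
    then have "r * \<bar>Im (Ln w)\<bar> \<le> r * 2" using r by (intro mult_left_mono) auto
    then show "\<bar>Im (\<psi> z)\<bar> \<le> 2 * r" using r by (simp add: \<psi>_def abs_mult flip: w_def)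
  qed
  have "- \<rho> \<le> Re (poly (complexify \<phi>) z) \<and> Re (poly (complexify \<phi>) z) \<le> 1 + \<rho> \<and>
      \<bar>Im (poly (complexify \<phi>) z)\<bar> \<le> \<rho>" if z: "norm z \<le> \<beta>" for z
    using strip[OF z] abs_Re_le_cmod[of "poly (complexify \<phi>) z - \<psi> z"]
      abs_Im_le_cmod[of "poly (complexify \<phi>) z - \<psi> z"] close[OF z] \<rho>
    unfolding r_def minus_complex.simps by argo
  moreover have "coeff \<phi> 0 = 0"
    by (simp add: \<phi>_def coeff_sum)
  moreover have "poly \<phi> 1 = 1"
    by (simp add: \<phi>_def poly_sum poly_monom c_def sum_distrib_left)
  ultimately show ?thesis using \<beta> by blast
qed

section \<open>Approximating the logarithm of the permanent\<close>

lemma poly_block_permanent: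
  "poly (block_permanent f R C) z = block_permanent (\<lambda>i j. poly (f i j) z) R C"
  by (simp add: block_permanent_def poly_sum poly_prod case_prod_unfold)

lemma complexify_block_permanent:
  "complexify (block_permanent f R C) = block_permanent (\<lambda>i j. complexify (f i j)) R C"
  by (simp add: block_permanent_def complexify_sum complexify_prod case_prod_unfold)

lemma block_permanent_pos:
  fixes f :: "'a \<Rightarrow> 'a \<Rightarrow> real"
  assumes "finite R" "\<And>i j. i \<in> R \<Longrightarrow> j \<in> R \<Longrightarrow> 0 < f i j"
  shows "0 < block_permanent f R R"
  unfolding block_permanent_def
proof (rule sum_pos)
  have "Id_on R \<in> matchings R R"
    by (auto simp: matchings_def)
  then show "matchings R R \<noteq> {}" by blast
  show "finite (matchings R R)" using assms(1) by (simp add: finite_matchings)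
  fix M assume "M \<in> matchings R R"
  then have "M \<subseteq> R \<times> R" by (simp add: matchings_def)
  then show "0 < (\<Prod>(i, j)\<in>M. f i j)"
    using assms(2) by (intro prod_pos) auto
qed

lemma degree_block_permanent_le:
  assumes "finite R" "finite C" "\<And>i j. i \<in> R \<Longrightarrow> j \<in> C \<Longrightarrow> degree (f i j) \<le> d"
  shows "degree (block_permanent f R C) \<le> card R * d"
  unfolding block_permanent_def
proof (rule degree_sum_le)
  show "finite (matchings R C)" using assms by (simp add: finite_matchings)
  fix M assume M: "M \<in> matchings R C"
  have fin: "finite M" using finite_matching[OF assms(1,2) M] .
  have sub: "M \<subseteq> R \<times> C" using M by (simp add: matchings_def)
  have "degree (\<Prod>(i, j)\<in>M. f i j) \<le> (\<Sum>p\<in>M. degree (case p of (i, j) \<Rightarrow> f i j))"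
    using degree_prod_sum_le[OF fin, of "\<lambda>(i, j). f i j"] by (simp add: o_def)
  also have "\<dots> \<le> (\<Sum>p\<in>M. d)"
    using assms(3) sub by (intro sum_mono) auto
  also have "\<dots> \<le> card R * d"
    using card_matching_le[OF assms(1) M] by simp
  finally show "degree (\<Prod>(i, j)\<in>M. f i j) \<le> card R * d" .
qed

text \<open>
The permanent along the path \<open>J + \<phi>(z) (A - J)\<close> from the all-ones matrix \<open>J\<close> at \<open>z = 0\<close> to the
matrix \<open>A\<close> with entries \<open>x\<close> at \<open>z = 1\<close>, as a polynomial in \<open>z\<close>.
\<close>
definition path_permanent :: "real poly \<Rightarrow> nat \<Rightarrow> (nat \<times> nat \<Rightarrow> real) \<Rightarrow> real poly" where
  "path_permanent \<phi> n x =
    block_permanent (\<lambda>i j. 1 + smult (x (i, j) - 1) \<phi>) {0..<n} {0..<n}"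

text \<open>
Since \<open>\<phi>\<close> has no constant term, every occurrence of an entry of the matrix is accompanied by at
least one power of \<open>z\<close>.
\<close>
lemma graded_path_permanent:
  assumes "coeff \<phi> 0 = 0"
  shows "graded ({0..<n} \<times> {0..<n}) (path_permanent \<phi> n)"
proof -
  have entry: "graded ({0..<n} \<times> {0..<n}) (\<lambda>x. 1 + smult (x v - 1) \<phi>)" if "v \<in> {0..<n} \<times> {0..<n}" for v
    unfolding graded_def
  proof
    fix k
    show "poly_fun ({0..<n} \<times> {0..<n}) k (\<lambda>x. coeff (1 + smult (x v - 1) \<phi>) k)"
    proof (cases "k = 0")
      case True
      then show ?thesis by (simp add: assms poly_fun_const)
    next
      case False
      have "poly_fun ({0..<n} \<times> {0..<n}) k (\<lambda>x. coeff \<phi> k * (x v - 1))"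
        using False that by (intro poly_fun_scale poly_fun_diff poly_fun_var poly_fun_const) auto
      then show ?thesis using False by (simp add: coeff_1 mult.commute)
    qed
  qed
  show ?thesis
    unfolding path_permanent_def block_permanent_def case_prod_unfold prod.collapse
    by (intro graded_sum graded_prod entry) (auto simp: matchings_def)
qed

lemma coeff_0_path_permanent:
  assumes "coeff \<phi> 0 = 0"
  shows "coeff (path_permanent \<phi> n x) 0 = block_permanent (\<lambda>i j. 1) {0..<n} {0..<n}"
  using assms by (simp add: path_permanent_def poly_block_permanent flip: poly_0_coeff_0)

text \<open>
For \<open>w = \<phi>(z)\<close> in the rectangle the entries \<open>1 - (1 - x) * w\<close> stay in the rectangle with
\<open>lo = \<delta> - \<rho>\<close>, \<open>hi = 1 + \<rho>\<close> and \<open>\<tau> = \<rho>\<close>. As \<open>\<rho> \<le> \<delta> / 8\<close>, \<open>lo\<close> is at least \<open>7 / 8 * \<delta>\<close>, and \<open>\<rho>\<close> of order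
\<open>\<delta>\<^sup>2\<close> is what the condition \<open>2 * hi * \<tau> + \<tau>\<^sup>2 < lo\<^sup>2\<close> requires.
\<close>
lemma path_permanent_nonzero:
  assumes \<delta>: "0 < \<delta>" "\<delta> \<le> 1"
    and x: "\<And>i j. i < n \<Longrightarrow> j < n \<Longrightarrow> \<delta> \<le> x (i, j) \<and> x (i, j) \<le> 1"
    and \<rho>: "\<rho> = \<delta>\<^sup>2 / 8"
    and w: "- \<rho> \<le> Re (poly (complexify \<phi>) z)" "Re (poly (complexify \<phi>) z) \<le> 1 + \<rho>"
      "\<bar>Im (poly (complexify \<phi>) z)\<bar> \<le> \<rho>"
  shows "poly (complexify (path_permanent \<phi> n x)) z \<noteq> 0"
proof -
  define w where "w = poly (complexify \<phi>) z"
  have "\<delta>\<^sup>2 \<le> \<delta> * 1" unfolding power2_eq_square using \<delta> by (intro mult_left_mono) auto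
  then have \<rho>_le: "\<rho> \<le> \<delta> / 8" and \<rho>0: "0 < \<rho>" using \<rho> \<delta> by (simp_all add: \<rho>)
  have "2 * (1 + \<rho>) * \<rho> + \<rho>\<^sup>2 = 2 * \<rho> + 3 * \<rho> * \<rho>" by (simp add: power2_eq_square algebra_simps)
  also have "\<dots> \<le> 2 * \<rho> + 3 * \<rho> * (1 / 8)"
    using \<rho>_le \<delta> \<rho>0 by (intro add_left_mono mult_left_mono) auto
  also have "\<dots> < (7 / 8 * \<delta>)\<^sup>2" using \<delta> by (simp add: \<rho> power_mult_distrib power_divide)
  also have "\<dots> \<le> (\<delta> - \<rho>)\<^sup>2" using \<rho>_le \<delta> by (intro power_mono) auto
  finally have dom: "2 * (1 + \<rho>) * \<rho> + \<rho>\<^sup>2 < (\<delta> - \<rho>)\<^sup>2" .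
  have adm: "in_rectangle (\<delta> - \<rho>) (1 + \<rho>) \<rho> (1 + of_real (x (i, j) - 1) * w)" if "i < n" "j < n" for i j
  proof -
    define t where "t = 1 - x (i, j)"
    have t: "0 \<le> t" "t \<le> 1 - \<delta>" "t \<le> 1" using x[OF that] \<delta> by (auto simp: t_def)
    have "t * Re w \<le> t * (1 + \<rho>)" using w t by (intro mult_left_mono) (auto simp: w_def)
    also have "\<dots> \<le> (1 - \<delta>) * (1 + \<rho>)" using t \<rho>0 by (intro mult_right_mono) auto
    also have "\<dots> \<le> 1 - (\<delta> - \<rho>)" using \<delta> \<rho>0 by (simp add: algebra_simps)
    finally have 1: "\<delta> - \<rho> \<le> 1 - t * Re w" by simp
    have "t * (- Re w) \<le> t * \<rho>" using w t by (intro mult_left_mono) (auto simp: w_def)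
    also have "\<dots> \<le> 1 * \<rho>" using t \<rho>0 by (intro mult_right_mono) auto
    finally have 2: "1 - t * Re w \<le> 1 + \<rho>" by simp
    have "t * \<bar>Im w\<bar> \<le> 1 * \<rho>" using w t by (intro mult_mono) (auto simp: w_def)
    then have 3: "\<bar>t * Im w\<bar> \<le> \<rho>" using t by (simp add: abs_mult)
    have "1 + of_real (x (i, j) - 1) * w = 1 - of_real t * w"
      by (simp add: t_def algebra_simps)
    then show ?thesis using 1 2 3 by (simp add: in_rectangle_def)
  qed
  have "poly (complexify (1 + smult c \<phi>)) z = 1 + of_real c * w" for c
  proof -
    have "complexify (1 + smult c \<phi>) = 1 + smult (of_real c) (complexify \<phi>)"
      by (rule poly_eqI) (simp add: coeff_map_poly coeff_1)
    then show ?thesis by (simp add: w_def)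
  qed
  then have "poly (complexify (path_permanent \<phi> n x)) z =
      block_permanent (\<lambda>i j. 1 + of_real (x (i, j) - 1) * w) {0..<n} {0..<n}"
    by (simp add: path_permanent_def complexify_block_permanent poly_block_permanent)
  also have "\<dots> \<noteq> 0"
    using adm \<rho>_le \<delta> by (intro block_permanent_nonzero[OF _ dom]) auto
  finally show ?thesis .
qed

text \<open>
Solving for the exponent gives \<open>m = (ln n + ln B - ln \<epsilon>) / ln \<beta>\<close>, rounded up. The bound
\<open>ln 2 \<le> ln (max 2 n) - ln \<epsilon>\<close> lets \<open>\<gamma>\<close> absorb \<open>ln B\<close> and the rounding.
\<close>
lemma degree_choice:
  fixes \<beta> B :: real
  assumes "1 < \<beta>" "1 \<le> B"
  shows "\<exists>\<gamma>>0. \<forall>n::nat. \<forall>\<epsilon>. 1 \<le> n \<longrightarrow> 0 < \<epsilon> \<longrightarrow> \<epsilon> < 1 \<longrightarrow>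
    (\<exists>m. real m \<le> \<gamma> * (ln (real (max 2 n)) - ln \<epsilon>) \<and> real n * B * (1 / \<beta>) ^ m \<le> \<epsilon>)"
proof -
  define \<kappa> where "\<kappa> = ln \<beta>"
  have \<kappa>: "0 < \<kappa>" using assms by (simp add: \<kappa>_def)
  have B: "0 \<le> ln B" using assms by simp
  define \<gamma> where "\<gamma> = (1 + (ln B + \<kappa>) / ln 2) / \<kappa>"
  have ln2: "0 < ln (2::real)" by simp
  have "0 \<le> (ln B + \<kappa>) / ln 2" using B \<kappa> by (intro divide_nonneg_pos) auto
  then have \<gamma>: "0 < \<gamma>" unfolding \<gamma>_def using \<kappa> by (intro divide_pos_pos) auto
  have "\<exists>m. real m \<le> \<gamma> * (ln (real (max 2 n)) - ln \<epsilon>) \<and> real n * B * (1 / \<beta>) ^ m \<le> \<epsilon>"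
    if n: "1 \<le> n" and \<epsilon>: "0 < \<epsilon>" "\<epsilon> < 1" for n :: nat and \<epsilon> :: real
  proof -
    define L where "L = ln (real (max 2 n)) - ln \<epsilon>"
    have "ln 2 \<le> ln (real (max 2 n))" by simp
    moreover have "ln \<epsilon> < 0" using \<epsilon> by simp
    ultimately have L: "ln 2 \<le> L" unfolding L_def by linarith
    define X where "X = (ln n + ln B - ln \<epsilon>) / \<kappa>"
    have "0 \<le> ln (real n)" using n by simp
    then have "0 \<le> ln n + ln B - ln \<epsilon>" using B \<open>ln \<epsilon> < 0\<close> by linarith
    then have X0: "0 \<le> X" unfolding X_def using \<kappa> by simp
    define m where "m = nat \<lceil>X\<rceil>"
    have m: "X \<le> real m" "real m \<le> X + 1" using X0 by (auto simp: m_def)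
    have "ln n \<le> ln (real (max 2 n))" using n by simp
    then have "X \<le> (L + ln B) / \<kappa>" unfolding X_def L_def using \<kappa> by (intro divide_right_mono) auto
    with m(2) have "real m \<le> (L + ln B) / \<kappa> + 1" by linarith
    also have "\<dots> = (L + (ln B + \<kappa>) * 1) / \<kappa>" using \<kappa> by (simp add: field_simps)
    also have "\<dots> \<le> (L + (ln B + \<kappa>) * (L / ln 2)) / \<kappa>"
      using L B \<kappa> ln2 by (intro divide_right_mono add_left_mono mult_left_mono) auto
    also have "\<dots> = \<gamma> * L" by (simp add: \<gamma>_def field_simps)
    finally have "real m \<le> \<gamma> * L" .
    moreover have "real n * B * (1 / \<beta>) ^ m \<le> \<epsilon>"
    proof -
      have "ln n + ln B - ln \<epsilon> \<le> real m * ln \<beta>"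
        using m(1) \<kappa> by (simp add: X_def \<kappa>_def field_simps)
      then have "ln (real n * B / \<epsilon>) \<le> ln (\<beta> ^ m)"
        using n assms \<epsilon> by (simp add: ln_mult ln_div ln_realpow)
      then have "real n * B / \<epsilon> \<le> \<beta> ^ m"
        using n assms \<epsilon> by (subst (asm) ln_le_cancel_iff) auto
      then show ?thesis using assms \<epsilon> by (simp add: field_simps power_one_over)
    qed
    ultimately show ?thesis unfolding L_def by blast
  qed
  with \<gamma> show ?thesis by blast
qed

(* max 2 n is n except for n = 1.  With ln (real n) in its place the case n = 1 is false:
   the degree bound tends to 0 as \<epsilon> tends to 1, which forces p to be constant, and a constant
   does not approximate ln a on \<delta> \<le> a \<le> 1 to within \<epsilon> < 1 when \<delta> < exp (- 2). *)
theorem theorem1p2: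
  fixes \<delta> :: real
  assumes "0 < \<delta>" and "\<delta> \<le> 1"
  shows "\<exists>\<gamma>>0. \<forall>n\<ge>1. \<forall>\<epsilon>. 0 < \<epsilon> \<and> \<epsilon> < 1 \<longrightarrow>
    (\<exists>p :: (nat \<times> nat, real) mpoly.
       mpoly_vars p \<subseteq> {0..<n} \<times> {0..<n} \<and>
       real (mpoly_degree p) \<le> \<gamma> * (ln (real (max 2 n)) - ln \<epsilon>) \<and>
       (\<forall>A \<in> carrier_mat n n.
          (\<forall>i<n. \<forall>j<n. \<delta> \<le> A $$ (i, j) \<and> A $$ (i, j) \<le> 1) \<longrightarrow>
          \<bar>ln (permanent A) - mpoly_eval (\<lambda>(i, j). A $$ (i, j)) p\<bar> \<le> \<epsilon>))"
proof -
  define \<rho> where "\<rho> = \<delta>\<^sup>2 / 8"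
  have "0 < \<rho>" using assms by (simp add: \<rho>_def)
  then obtain \<phi> \<beta> where \<beta>: "1 < \<beta>" and \<phi>0: "coeff \<phi> 0 = 0" and \<phi>1: "poly \<phi> 1 = 1"
    and strip: "\<And>z. norm z \<le> \<beta> \<Longrightarrow> - \<rho> \<le> Re (poly (complexify \<phi>) z) \<and>
      Re (poly (complexify \<phi>) z) \<le> 1 + \<rho> \<and> \<bar>Im (poly (complexify \<phi>) z)\<bar> \<le> \<rho>"
    using polynomial_disc_to_strip by blast
  define B where "B = (real (degree \<phi>) + 1) / (1 - 1 / \<beta>)"
  have "0 < 1 - 1 / \<beta>" using \<beta> by simp
  have "1 * (1 - 1 / \<beta>) \<le> real (degree \<phi>) + 1" using \<beta> by (simp add: add_increasing)
  then have B: "1 \<le> B"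
    unfolding B_def using \<open>0 < 1 - 1 / \<beta>\<close> by (subst pos_le_divide_eq)
  obtain \<gamma> where \<gamma>: "0 < \<gamma>" and m_ex: "\<And>n \<epsilon>. 1 \<le> n \<Longrightarrow> 0 < \<epsilon> \<Longrightarrow> \<epsilon> < 1 \<Longrightarrow>
      \<exists>m. real m \<le> \<gamma> * (ln (real (max 2 n)) - ln \<epsilon>) \<and> real n * B * (1 / \<beta>) ^ m \<le> \<epsilon>"
    using degree_choice[OF \<beta> B] by blast
  have "\<exists>p :: (nat \<times> nat, real) mpoly.
       mpoly_vars p \<subseteq> {0..<n} \<times> {0..<n} \<and>
       real (mpoly_degree p) \<le> \<gamma> * (ln (real (max 2 n)) - ln \<epsilon>) \<and>
       (\<forall>A \<in> carrier_mat n n.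
          (\<forall>i<n. \<forall>j<n. \<delta> \<le> A $$ (i, j) \<and> A $$ (i, j) \<le> 1) \<longrightarrow>
          \<bar>ln (permanent A) - mpoly_eval (\<lambda>(i, j). A $$ (i, j)) p\<bar> \<le> \<epsilon>)"
    if n: "1 \<le> n" and \<epsilon>: "0 < \<epsilon>" "\<epsilon> < 1" for n \<epsilon>
  proof -
    let ?V = "{0..<n} \<times> {0..<n}"
    obtain m where m: "real m \<le> \<gamma> * (ln (real (max 2 n)) - ln \<epsilon>)" "real n * B * (1 / \<beta>) ^ m \<le> \<epsilon>"
      using m_ex[OF n \<epsilon>] by blast
    define H where "H = path_permanent \<phi> n"
    define c :: real where "c = block_permanent (\<lambda>i j. 1) {0..<n} {0..<n}"
    have c: "coeff (H x) 0 = c" for x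
      using coeff_0_path_permanent[OF \<phi>0] by (simp add: H_def c_def)
    have c0: "c \<noteq> 0"
      unfolding c_def by (rule less_imp_neq[THEN not_sym], rule block_permanent_pos) auto
    have "graded ?V H" unfolding H_def using \<phi>0 by (rule graded_path_permanent)
    then have L: "poly_fun ?V (Suc k) (\<lambda>x. fps_nth (log_deriv (H x)) k)" for k
      using c c0 by (rule poly_fun_log_deriv)
    define F where "F = (\<lambda>x. ln \<bar>c\<bar> + (\<Sum>k=1..m. (1 / real k) * fps_nth (log_deriv (H x)) (k - 1)))"
    have "poly_fun ?V m F"
      unfolding F_def
      by (intro poly_fun.add poly_fun_sum poly_fun_scale poly_fun_const poly_fun_mono[OF L]) auto
    then obtain p where p: "mpoly_vars p \<subseteq> ?V" "mpoly_degree p \<le> m" "\<And>x. mpoly_eval x p = F x"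
      using mpoly_of_poly_fun by blast
    have "\<bar>ln (permanent A) - mpoly_eval (\<lambda>(i, j). A $$ (i, j)) p\<bar> \<le> \<epsilon>"
      if A: "A \<in> carrier_mat n n" and bd: "\<forall>i<n. \<forall>j<n. \<delta> \<le> A $$ (i, j) \<and> A $$ (i, j) \<le> 1" for A
    proof -
      define x where "x = (\<lambda>(i, j). A $$ (i, j))"
      have per: "permanent A = block_permanent (\<lambda>i j. x (i, j)) {0..<n} {0..<n}"
        using permanent_eq_block_permanent[OF A] by (simp add: x_def)
      have "0 < permanent A"
        unfolding per using bd assms by (intro block_permanent_pos) (auto simp: x_def intro: less_le_trans)
      moreover have "poly (H x) 1 = permanent A"
        by (simp add: H_def path_permanent_def poly_block_permanent \<phi>1 per)
      ultimately have "ln (permanent A) = ln \<bar>poly (H x) 1\<bar>" by simp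
      moreover have "mpoly_eval x p =
          ln \<bar>coeff (H x) 0\<bar> + (\<Sum>k=1..m. fps_nth (log_deriv (H x)) (k - 1) / real k)"
        by (simp add: p(3) F_def c)
      moreover have "\<bar>ln \<bar>poly (H x) 1\<bar> - (ln \<bar>coeff (H x) 0\<bar> +
          (\<Sum>k=1..m. fps_nth (log_deriv (H x)) (k - 1) / real k))\<bar>
        \<le> real (degree (H x)) * ((1 / \<beta>) ^ Suc m / (1 - 1 / \<beta>))"
      proof (rule ln_poly_truncation[OF \<beta>])
        fix z :: complex assume "norm z \<le> \<beta>"
        then show "poly (complexify (H x)) z \<noteq> 0"
          unfolding H_def using strip bd assms
          by (intro path_permanent_nonzero[of \<delta> n x \<rho>]) (auto simp: x_def \<rho>_def)
      qed
      moreover have "\<dots> \<le> \<epsilon>"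
      proof -
        have "degree (H x) \<le> card {0..<n} * degree \<phi>"
          unfolding H_def path_permanent_def
          by (intro degree_block_permanent_le) (auto intro!: degree_add_le degree_smult_le)
        then have "degree (H x) \<le> n * (degree \<phi> + 1)" by simp
        then have "real (degree (H x)) \<le> real n * (real (degree \<phi>) + 1)"
          by (metis of_nat_1 of_nat_add of_nat_le_iff of_nat_mult)
        moreover have "(1 / \<beta>) ^ Suc m \<le> (1 / \<beta>) ^ m"
          using \<beta> by (intro power_decreasing) auto
        ultimately have "real (degree (H x)) * ((1 / \<beta>) ^ Suc m / (1 - 1 / \<beta>))
            \<le> (real n * (real (degree \<phi>) + 1)) * ((1 / \<beta>) ^ m / (1 - 1 / \<beta>))"
          using \<beta> \<open>0 < 1 - 1 / \<beta>\<close> by (intro mult_mono divide_right_mono) auto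
        also have "\<dots> = real n * B * (1 / \<beta>) ^ m" by (simp add: B_def)
        finally show ?thesis using m(2) by linarith
      qed
      ultimately show ?thesis unfolding x_def by linarith
    qed
    moreover have "real (mpoly_degree p) \<le> \<gamma> * (ln (real (max 2 n)) - ln \<epsilon>)"
      using p(2) m(1) by linarith
    ultimately show ?thesis using p(1) by blast
  qed
  with \<gamma> show ?thesis by blast
qed

end
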